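(* Let $0<\alpha\le 1$, $T>0$, $R>0$. Let $A$ be a densely defined, self-adjoint, bounded above linear operator with compact resolvent on a separable Hilbert space $H$. Let $K\ge 1$ be a constant such that every solution $u$ of $\partial_t^\alpha u=Au$ on $(0,T)$ satisfies $\|u(t)\|\le K\|u(0)\|^{1-\frac tT}\|u(T)\|^{\frac tT}$ for $0\le t\le T$. Let $u_0\in D(A)$ with $\|Au_0\|\le R$ and $\|u_0\|\le R$, and let $u$ be the solution of $\partial_t^\alpha u=Au$ on $(0,T)$ with $u(0)=u_0$. Then there exists a constant $\theta\in(0,\tfrac12)$, depending on $u_0$, such that $$\|u_0\|\le\|u(T)\|^{\theta}\sqrt{\|u(T)\|^{2-2\theta}+K R^{2-2\theta}\,\frac{2T^\alpha}{\alpha\Gamma(\alpha)}}.$$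
   Context: $(H,\langle\cdot,\cdot\rangle)$ is a separable Hilbert space with norm $\|\cdot\|$. The operator $A:D(A)\subset H\to H$ is densely defined and linear and satisfies: (i) $A$ is self-adjoint; (ii) there is $\kappa\ge 0$ with $\langle Au,u\rangle\le\kappa\|u\|^2$ for all $u\in D(A)$; (iii) there is $\lambda>-\kappa$ such that the resolvent $(\lambda I-A)^{-1}$ exists and is compact. Consequently there is an orthonormal basis $\{\varphi_n\}_{n\in\mathbb{N}}$ of $H$ with $\varphi_n\in D(A)$, $-A\varphi_n=\lambda_n\varphi_n$, and $-\kappa\le\lambda_1\le\lambda_2\le\cdots\to\infty$. The Caputo derivative is $\partial_t^\alpha g(t)=\frac{1}{\Gamma(1-\alpha)}\int_0^t(t-s)^{-\alpha}g'(s)\,ds$ for $0<\alpha<1$ and $\partial_t^1 g=g'$; $\Gamma$ is the Gamma function. The Mittag-Leffler function is $E_{\alpha,\beta}(z)=\sum_{k=0}^\infty\frac{z^k}{\Gamma(\alpha k+\beta)}$. Solutions: for $u_0\in H$ the solution of $\partial_t^\alpha u=Au$ on $(0,T)$ with $u(0)=u_0$ is $u(t)=\sum_{n=1}^\infty\langle u_0,\varphi_n\rangle E_{\alpha,1}(-\lambda_n t^\alpha)\varphi_n$, $t\in[0,T]$, which lies in $C([0,T];H)$. A constant $K\ge1$ as in the claim exists, depending only on $A,\alpha,T$. *)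

theory Defs
  imports "HOL-Analysis.Analysis"
begin

text \<open>
  An unbounded operator on a real Hilbert space is a pair of a domain \<open>D\<close> and a function \<open>A\<close>
  that matters only on \<open>D\<close>. A complex Hilbert space is covered by restriction of scalars, with the
  real part of its inner product.
\<close>

definition operator_on :: "'a::real_inner set \<Rightarrow> ('a \<Rightarrow> 'a) \<Rightarrow> bool" where
  "operator_on D A \<longleftrightarrow> subspace D \<and>
     (\<forall>x\<in>D. \<forall>y\<in>D. A (x + y) = A x + A y) \<and> (\<forall>c. \<forall>x\<in>D. A (c *\<^sub>R x) = c *\<^sub>R A x)"

definition densely_defined :: "'a::real_inner set \<Rightarrow> bool" where
  "densely_defined D \<longleftrightarrow> closure D = UNIV"

definition op_graph :: "'a set \<Rightarrow> ('a \<Rightarrow> 'a) \<Rightarrow> ('a \<times> 'a) set" where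
  "op_graph D A = {(v, A v) | v. v \<in> D}"

definition adjoint_graph :: "'a::real_inner set \<Rightarrow> ('a \<Rightarrow> 'a) \<Rightarrow> ('a \<times> 'a) set" where
  "adjoint_graph D A = {(v, w). \<forall>x\<in>D. inner (A x) v = inner x w}"

text \<open>Equality of graphs includes equality of the domains of the operator and its adjoint.\<close>

definition self_adjoint :: "'a::real_inner set \<Rightarrow> ('a \<Rightarrow> 'a) \<Rightarrow> bool" where
  "self_adjoint D A \<longleftrightarrow> adjoint_graph D A = op_graph D A"

definition compact_operator :: "('a::real_normed_vector \<Rightarrow> 'b::real_normed_vector) \<Rightarrow> bool" where
  "compact_operator F \<longleftrightarrow> bounded_linear F \<and> (\<forall>S. bounded S \<longrightarrow> compact (closure (F ` S)))"

definition has_compact_resolvent_at :: "'a::real_inner set \<Rightarrow> ('a \<Rightarrow> 'a) \<Rightarrow> real \<Rightarrow> bool" where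
  "has_compact_resolvent_at D A l \<longleftrightarrow>
     bij_betw (\<lambda>x. l *\<^sub>R x - A x) D UNIV \<and>
     compact_operator (the_inv_into D (\<lambda>x. l *\<^sub>R x - A x))"

definition admissible_operator :: "'a::real_inner set \<Rightarrow> ('a \<Rightarrow> 'a) \<Rightarrow> bool" where
  "admissible_operator D A \<longleftrightarrow>
     operator_on D A \<and> densely_defined D \<and> self_adjoint D A \<and>
     (\<exists>\<kappa>\<ge>0. (\<forall>x\<in>D. inner (A x) x \<le> \<kappa> * (norm x)\<^sup>2) \<and>
            (\<exists>l>-\<kappa>. has_compact_resolvent_at D A l))"

text \<open>
  The index set \<open>I\<close> is all of the naturals when the space has infinite dimension, and an initial
  segment of length the dimension otherwise. Indices start at 0.
\<close>

definition eigenbasis ::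
  "'a::real_inner set \<Rightarrow> ('a \<Rightarrow> 'a) \<Rightarrow> nat set \<Rightarrow> (nat \<Rightarrow> 'a) \<Rightarrow> (nat \<Rightarrow> real) \<Rightarrow> bool" where
  "eigenbasis D A I \<phi> lam \<longleftrightarrow>
     (I = UNIV \<or> (\<exists>N. I = {..<N})) \<and>
     (\<forall>m\<in>I. \<forall>n\<in>I. inner (\<phi> m) (\<phi> n) = (if m = n then 1 else 0)) \<and>
     closure (span (\<phi> ` I)) = UNIV \<and>
     (\<forall>n\<in>I. \<phi> n \<in> D \<and> - A (\<phi> n) = lam n *\<^sub>R \<phi> n) \<and>
     mono_on I lam \<and>
     (I = UNIV \<longrightarrow> filterlim lam at_top sequentially)"

definition mittag_leffler :: "real \<Rightarrow> real \<Rightarrow> real \<Rightarrow> real" where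
  "mittag_leffler \<alpha> \<beta> z = (\<Sum>k. z ^ k / Gamma (\<alpha> * real k + \<beta>))"

text \<open>
  The solution on \<open>[0, T]\<close> of the equation whose time derivative is the Caputo derivative of order
  \<open>\<alpha>\<close> and whose right-hand side is \<open>A u\<close>, with initial value \<open>u0\<close>, is by definition the
  eigenfunction expansion. It does not depend on the choice of the eigenbasis.
\<close>

definition is_solution ::
  "'a::real_inner set \<Rightarrow> ('a \<Rightarrow> 'a) \<Rightarrow> real \<Rightarrow> real \<Rightarrow> 'a \<Rightarrow> (real \<Rightarrow> 'a) \<Rightarrow> bool" where
  "is_solution D A \<alpha> T u0 u \<longleftrightarrow>
     (\<exists>I \<phi> lam. eigenbasis D A I \<phi> lam \<and>
        (\<forall>t\<in>{0..T}.
           (\<lambda>n. if n \<in> I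
                then (inner u0 (\<phi> n) * mittag_leffler \<alpha> 1 (- lam n * t powr \<alpha>)) *\<^sub>R \<phi> n
                else 0) sums u t))"

text \<open>Real power with the convention that \<open>0\<close> to the power \<open>0\<close> is \<open>1\<close>, unlike \<open>powr\<close>.\<close>

definition rpow :: "real \<Rightarrow> real \<Rightarrow> real" where
  "rpow x p = (if p = 0 then 1 else x powr p)"

end

theory Submission
  imports Defs
begin

text \<open>
  Write \<open>c n\<close> for the coefficients of \<open>u0\<close> in the eigenbasis and \<open>E\<close> for the Mittag-Leffler function
  with parameters \<open>\<alpha>\<close> and \<open>1\<close>. The whole argument rests on the scalar inequality
  \<open>1 + z / Gamma (\<alpha> + 1) \<le> E z\<close> for all real \<open>z\<close> (\<open>mittag_leffler_ge_linear\<close>), the fractional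
  analogue of \<open>1 + z \<le> exp z\<close>. With \<open>z = - lam n * t powr \<alpha>\<close>, multiplied by the square of \<open>c n\<close>
  and summed over \<open>n\<close>, it becomes
  \<open>(norm u0)\<^sup>2 - inner (u t) u0 \<le> t powr \<alpha> / Gamma (\<alpha> + 1) * - inner (A u0) u0\<close>
  (\<open>solution_decay_estimate\<close>): both \<open>(norm u0)\<^sup>2\<close> and \<open>- inner (A u0) u0\<close> are sums over the
  spectrum, and eigenvalues of either sign are covered because the inequality holds on the whole line.

  At \<open>t = T\<close> the right-hand side is at most \<open>M * R\<^sup>2\<close>, hence at most \<open>K * M * R\<^sup>2\<close>, where
  \<open>M = T powr \<alpha> / (\<alpha> * Gamma \<alpha>)\<close>. Together with
  \<open>2 * inner (u T) u0 \<le> (norm (u T))\<^sup>2 + (norm u0)\<^sup>2\<close> this is the asserted estimate with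
  \<open>\<theta> = 0\<close>. It holds strictly: the last inequality is an equality only if the two norms agree, and in
  that case the positive term \<open>2 * K * M * R\<^sup>2\<close> gives strictness. If \<open>u T\<close> is not zero, then the
  asserted bound is continuous in \<open>\<theta>\<close>, so the estimate persists for small positive \<open>\<theta>\<close>. If
  \<open>u T = 0\<close>, then the assumed interpolation inequality makes \<open>u\<close> vanish on the open interval from
  \<open>0\<close> to \<open>T\<close>, and the decay estimate with \<open>t\<close> tending to \<open>0\<close> shows \<open>u0 = 0\<close>.

  For \<open>z \<ge> 0\<close> the scalar inequality just truncates the power series. For \<open>z = - y < 0\<close> the series
  alternates, and the inequality is obtained by discretizing the fractional relaxation equation that
  \<open>\<lambda>t. E (- y * t powr \<alpha>)\<close> solves. The discrete solution is a convergent series whose convolutions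
  with the coefficients of \<open>(1 - z) powr \<alpha>\<close> and \<open>(1 - z) powr - \<alpha>\<close> are given by the Vandermonde
  identity. The signs of these coefficients give the bounds \<open>0\<close> and \<open>1\<close> for the discrete solution,
  and then its linear lower bound. All of this passes to the limit by Tannery's theorem.
\<close>

section \<open>Coefficients of the negative binomial series\<close>

text \<open>
  The coefficient of \<open>z ^ m\<close> in the expansion of \<open>(1 - z) powr - a\<close>.
\<close>

definition binom_coeff :: "real \<Rightarrow> nat \<Rightarrow> real" where
  "binom_coeff a m = pochhammer a m / fact m"

lemma binom_coeff_0 [simp]: "binom_coeff a 0 = 1"
  by (simp add: binom_coeff_def)

lemma binom_coeff_one: "binom_coeff 1 m = 1"
  by (simp add: binom_coeff_def flip: pochhammer_fact)

lemma binom_coeff_nonneg: "0 \<le> a \<Longrightarrow> 0 \<le> binom_coeff a m"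
  by (simp add: binom_coeff_def pochhammer_prod prod_nonneg)

lemma binom_coeff_minus_nonpos:
  assumes "0 \<le> a" "a \<le> 1" "0 < m"
  shows "binom_coeff (- a) m \<le> 0"
proof -
  obtain k where m: "m = Suc k"
    using assms(3) gr0_implies_Suc by blast
  have "0 \<le> pochhammer (1 - a) k"
    using assms(2) by (simp add: pochhammer_prod prod_nonneg)
  then show ?thesis
    using assms(1) by (simp add: binom_coeff_def m pochhammer_rec mult_nonneg_nonneg del: fact_Suc)
qed

text \<open>
  The Vandermonde identity, that is, the product of the expansions of \<open>(1 - z) powr - a\<close> and
  \<open>(1 - z) powr - b\<close>.
\<close>

lemma binom_coeff_convolution:
  "(\<Sum>j\<le>m. binom_coeff a j * binom_coeff b (m - j)) = binom_coeff (a + b) m"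
proof -
  have "binom_coeff (a + b) m
    = (\<Sum>j\<le>m. real (m choose j) * pochhammer a j * pochhammer b (m - j) / fact m)"
    unfolding binom_coeff_def pochhammer_binomial_sum sum_divide_distrib ..
  also have "\<dots> = (\<Sum>j\<le>m. binom_coeff a j * binom_coeff b (m - j))"
    by (intro sum.cong refl) (simp add: binom_coeff_def binomial_fact field_simps)
  finally show ?thesis by simp
qed

text \<open>
  In \<open>k\<close> the coefficient grows like a polynomial of degree \<open>m\<close>. Since \<open>\<alpha> \<le> 1\<close>, the series is dominated
  by the binomial series for \<open>(1 - \<bar>x\<bar>) powr - (m + 1)\<close>.
\<close>

lemma summable_binom_coeff:
  fixes x :: real
  assumes "0 \<le> \<alpha>" "\<alpha> \<le> 1" "\<bar>x\<bar> < 1"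
  shows "summable (\<lambda>k. \<bar>x\<bar> ^ k * binom_coeff (\<alpha> * real k + 1) m)"
proof (rule summable_comparison_test')
  show "summable (\<lambda>k. ((- real m - 1) gchoose k) * (- \<bar>x\<bar>) ^ k)"
    using gen_binomial_real[of "- \<bar>x\<bar>" "- real m - 1"] assms(3) by (simp add: sums_iff)
  fix k :: nat assume "0 \<le> k"
  have "binom_coeff (\<alpha> * real k + 1) m \<le> binom_coeff (real k + 1) m"
    unfolding binom_coeff_def pochhammer_prod using assms(1,2)
    by (intro divide_right_mono prod_mono) (auto intro: mult_left_le_one_le)
  also have "\<dots> = binom_coeff (real m + 1) k"
  proof -
    have "pochhammer (real i + 1) j = fact (i + j) / fact i" for i j
    proof -
      have "fact (i + j) = (fact i :: real) * pochhammer (real i + 1) j"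
        using pochhammer_product'[of "1::real" i j] by (simp add: add.commute flip: pochhammer_fact)
      then show ?thesis by simp
    qed
    then show ?thesis by (simp add: binom_coeff_def add.commute)
  qed
  finally have "binom_coeff (\<alpha> * real k + 1) m \<le> binom_coeff (real m + 1) k" .
  moreover have "((- real m - 1) gchoose k) * (- \<bar>x\<bar>) ^ k = \<bar>x\<bar> ^ k * binom_coeff (real m + 1) k"
  proof -
    have "(- \<bar>x\<bar>) ^ k = (- 1) ^ k * \<bar>x\<bar> ^ k"
      by (rule power_minus)
    moreover have "(- 1) ^ k * (- 1) ^ k = (1 :: real)"
      by (simp flip: power_mult_distrib)
    ultimately show ?thesis
      by (simp add: gbinomial_pochhammer binom_coeff_def add.commute)
  qed
  ultimately show "norm (\<bar>x\<bar> ^ k * binom_coeff (\<alpha> * real k + 1) m)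
      \<le> ((- real m - 1) gchoose k) * (- \<bar>x\<bar>) ^ k"
    using assms(1) by (simp add: binom_coeff_nonneg abs_mult mult_left_mono)
qed

section \<open>The discrete fractional relaxation equation\<close>

text \<open>
  The coefficient of \<open>z ^ m\<close> in \<open>(1 - z) powr (\<alpha> - 1) / ((1 - z) powr \<alpha> + x)\<close>, expanded in powers
  of \<open>x\<close>. As a sequence in \<open>m\<close> it solves the implicit difference scheme for the relaxation equation in
  which multiplication of the generating function by \<open>(1 - z) powr \<alpha>\<close> replaces the fractional
  derivative and \<open>x\<close> is the rate constant times the step size to the power \<open>\<alpha>\<close>.
\<close>

definition discrete_mittag_leffler :: "real \<Rightarrow> real \<Rightarrow> nat \<Rightarrow> real" where
  "discrete_mittag_leffler \<alpha> x m = (\<Sum>k. (- x) ^ k * binom_coeff (\<alpha> * real k + 1) m)"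

context
  fixes \<alpha> x :: real
  assumes \<alpha>: "0 \<le> \<alpha>" "\<alpha> \<le> 1" and x: "0 \<le> x" "x < 1"
begin

lemma discrete_mittag_leffler_sums:
  "(\<lambda>k. (- x) ^ k * binom_coeff (\<alpha> * real k + 1) m) sums discrete_mittag_leffler \<alpha> x m"
  unfolding discrete_mittag_leffler_def
proof (rule summable_sums[OF summable_rabs_cancel])
  show "summable (\<lambda>k. \<bar>(- x) ^ k * binom_coeff (\<alpha> * real k + 1) m\<bar>)"
    using summable_binom_coeff[OF \<alpha>, of x m] x \<alpha>
    by (simp add: abs_mult power_abs binom_coeff_nonneg)
qed

text \<open>
  Multiplying the generating function by \<open>(1 - z) powr - b\<close> shifts the exponent in every term of the
  series by \<open>b\<close>. For \<open>b = - \<alpha>\<close> and \<open>b = \<alpha>\<close> this shifts the index \<open>k\<close> by one, which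
  yields the next two equations.
\<close>

lemma discrete_mittag_leffler_convolution:
  "(\<lambda>k. (- x) ^ k * binom_coeff (b + \<alpha> * real k + 1) m) sums
     (\<Sum>j\<le>m. binom_coeff b j * discrete_mittag_leffler \<alpha> x (m - j))"
proof -
  have "(\<lambda>k. \<Sum>j\<le>m. binom_coeff b j * ((- x) ^ k * binom_coeff (\<alpha> * real k + 1) (m - j))) sums
      (\<Sum>j\<le>m. binom_coeff b j * discrete_mittag_leffler \<alpha> x (m - j))"
    by (intro sums_sum sums_mult discrete_mittag_leffler_sums)
  moreover have "(\<Sum>j\<le>m. binom_coeff b j * ((- x) ^ k * binom_coeff (\<alpha> * real k + 1) (m - j)))
      = (- x) ^ k * binom_coeff (b + \<alpha> * real k + 1) m" for k
    using binom_coeff_convolution[where a=b and b="\<alpha> * real k + 1" and m=m]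
    by (simp add: sum_distrib_left mult_ac add.assoc flip: binom_coeff_convolution)
  ultimately show ?thesis by simp
qed

lemma discrete_mittag_leffler_fractional_difference:
  "(\<Sum>j\<le>m. binom_coeff (- \<alpha>) j * discrete_mittag_leffler \<alpha> x (m - j))
     = binom_coeff (1 - \<alpha>) m - x * discrete_mittag_leffler \<alpha> x m"
proof -
  have "(\<lambda>k. (- x) ^ Suc k * binom_coeff (- \<alpha> + \<alpha> * real (Suc k) + 1) m) sums
      (- x * discrete_mittag_leffler \<alpha> x m)"
  proof -
    have "- \<alpha> + \<alpha> * real (Suc k) + 1 = \<alpha> * real k + 1" for k
      by (simp add: algebra_simps)
    then show ?thesis
      using sums_mult[OF discrete_mittag_leffler_sums, of "- x" m]
      by (simp only: power_Suc mult.assoc)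
  qed
  then have "(\<lambda>k. (- x) ^ k * binom_coeff (- \<alpha> + \<alpha> * real k + 1) m) sums
      (- x * discrete_mittag_leffler \<alpha> x m + binom_coeff (1 - \<alpha>) m)"
    by (subst (asm) sums_Suc_iff) simp
  then show ?thesis
    using discrete_mittag_leffler_convolution[of "- \<alpha>" m] by (simp add: sums_iff)
qed

lemma discrete_mittag_leffler_fractional_sum:
  "1 - discrete_mittag_leffler \<alpha> x m
     = x * (\<Sum>j\<le>m. binom_coeff \<alpha> j * discrete_mittag_leffler \<alpha> x (m - j))"
proof -
  have "(\<lambda>k. (- x) ^ Suc k * binom_coeff (\<alpha> * real (Suc k) + 1) m) sums
      (- x * (\<Sum>j\<le>m. binom_coeff \<alpha> j * discrete_mittag_leffler \<alpha> x (m - j)))"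
  proof -
    have "\<alpha> * real (Suc k) + 1 = \<alpha> + \<alpha> * real k + 1" for k
      by (simp add: algebra_simps)
    then show ?thesis
      using sums_mult[OF discrete_mittag_leffler_convolution, of "- x" \<alpha> m]
      by (simp only: power_Suc mult.assoc)
  qed
  then have "(\<lambda>k. (- x) ^ k * binom_coeff (\<alpha> * real k + 1) m) sums
      (- x * (\<Sum>j\<le>m. binom_coeff \<alpha> j * discrete_mittag_leffler \<alpha> x (m - j)) + 1)"
    by (subst (asm) sums_Suc_iff) (simp add: binom_coeff_one)
  then show ?thesis
    using discrete_mittag_leffler_sums[of m] by (simp add: sums_iff)
qed

text \<open>
  In the difference scheme the coefficient of the newest value is \<open>1 + x\<close>. All older values enter with
  the coefficients of \<open>- (1 - z) powr \<alpha>\<close> of positive index, which are nonnegative because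
  \<open>\<alpha> \<le> 1\<close>, and so is the inhomogeneity. So the scheme propagates nonnegativity.
\<close>

lemma discrete_mittag_leffler_nonneg: "0 \<le> discrete_mittag_leffler \<alpha> x m"
proof (induction m rule: less_induct)
  case (less m)
  have "(1 + x) * discrete_mittag_leffler \<alpha> x m = binom_coeff (1 - \<alpha>) m
      + (\<Sum>j\<in>{..m} - {0}. - binom_coeff (- \<alpha>) j * discrete_mittag_leffler \<alpha> x (m - j))"
    using discrete_mittag_leffler_fractional_difference[of m]
    by (subst (asm) sum.remove[of _ 0]) (auto simp: algebra_simps sum_negf)
  also have "\<dots> \<ge> 0"
    using \<alpha> less binom_coeff_minus_nonpos[OF \<alpha>]
    by (intro add_nonneg_nonneg sum_nonneg mult_nonneg_nonneg binom_coeff_nonneg) auto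
  finally show ?case
    using x by (simp add: zero_le_mult_iff)
qed

text \<open>
  The summed form of the scheme expresses the distance to \<open>1\<close> as \<open>x\<close> times a combination of earlier
  values with nonnegative weights. Nonnegativity of the values makes the distance nonnegative, so all
  values are at most \<open>1\<close>; inserting this bound on the right limits the distance to \<open>x\<close> times the sum
  of the weights.
\<close>

lemma discrete_mittag_leffler_ge:
  "1 - x * binom_coeff (\<alpha> + 1) m \<le> discrete_mittag_leffler \<alpha> x m"
proof -
  have le1: "discrete_mittag_leffler \<alpha> x n \<le> 1" for n
  proof -
    have "0 \<le> 1 - discrete_mittag_leffler \<alpha> x n"
      unfolding discrete_mittag_leffler_fractional_sum using x \<alpha>
      by (intro mult_nonneg_nonneg sum_nonneg binom_coeff_nonneg discrete_mittag_leffler_nonneg)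
    then show ?thesis by simp
  qed
  have "1 - discrete_mittag_leffler \<alpha> x m
      \<le> x * (\<Sum>j\<le>m. binom_coeff \<alpha> j * binom_coeff 1 (m - j))"
    unfolding discrete_mittag_leffler_fractional_sum binom_coeff_one using x \<alpha> le1
    by (intro mult_left_mono sum_mono binom_coeff_nonneg)
  then show ?thesis
    by (simp add: binom_coeff_convolution)
qed

end

section \<open>Passage to the Mittag-Leffler function\<close>

lemma binom_coeff_asymptotics:
  assumes "0 \<le> a"
  shows "(\<lambda>n. binom_coeff (a + 1) n / real n powr a) \<longlonglongrightarrow> 1 / Gamma (a + 1)"
proof (rule Lim_transform_eventually)
  show "(\<lambda>n. 1 / Gamma_series' (a + 1) n) \<longlonglongrightarrow> 1 / Gamma (a + 1)"
    using Gamma_real_pos[of "a + 1"] assms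
    by (intro tendsto_divide Gamma_series'_LIMSEQ tendsto_const) linarith
  show "\<forall>\<^sub>F n in sequentially. 1 / Gamma_series' (a + 1) n = binom_coeff (a + 1) n / real n powr a"
    using eventually_gt_at_top[of 0]
  proof eventually_elim
    case (elim n)
    then have "(fact n :: real) = real n * fact (n - 1)"
      by (simp add: fact_reduce)
    with elim show ?case
      by (simp add: Gamma_series'_def binom_coeff_def powr_def distrib_right exp_add field_simps)
  qed
qed

text \<open>
  Consecutive ratios are \<open>(1 + a / (n + 1)) * (1 - 1 / (n + 1)) powr a\<close>, at most
  \<open>exp (a / (n + 1)) * exp (- a / (n + 1)) = 1\<close>. The monotonicity lets a single index dominate all later
  ones, uniformly in the exponent.
\<close>

lemma binom_coeff_ratio_antimono:
  assumes "0 \<le> a" "0 < m" "m \<le> n"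
  shows "binom_coeff (a + 1) n / real n powr a \<le> binom_coeff (a + 1) m / real m powr a"
  using assms(3)
proof (induction n rule: dec_induct)
  case (step n)
  have n: "0 < n" using assms(2) step.hyps by simp
  have "(1 + a / real (Suc n)) * (real n / real (Suc n)) powr a \<le> 1"
  proof -
    have "real n / real (Suc n) \<le> exp (- 1 / real (Suc n))"
      using exp_ge_add_one_self[of "- 1 / real (Suc n)"] by (simp add: field_simps)
    then have "(real n / real (Suc n)) powr a \<le> exp (- 1 / real (Suc n)) powr a"
      using assms(1) by (intro powr_mono2) auto
    also have "\<dots> = exp (- (a / real (Suc n)))"
      by (simp add: powr_def)
    finally have "(1 + a / real (Suc n)) * (real n / real (Suc n)) powr a
        \<le> exp (a / real (Suc n)) * exp (- (a / real (Suc n)))"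
      using assms(1) exp_ge_add_one_self[of "a / real (Suc n)"] by (intro mult_mono) auto
    then show ?thesis by (simp flip: exp_add)
  qed
  moreover have "binom_coeff (a + 1) (Suc n) / real (Suc n) powr a
      = binom_coeff (a + 1) n / real n powr a
        * ((1 + a / real (Suc n)) * (real n / real (Suc n)) powr a)"
  proof -
    have "binom_coeff (a + 1) (Suc n) = binom_coeff (a + 1) n * (1 + a / real (Suc n))"
      by (simp add: binom_coeff_def pochhammer_Suc divide_simps)
    moreover have "real n powr a \<noteq> 0" using n by simp
    ultimately show ?thesis by (simp add: powr_divide)
  qed
  ultimately have "binom_coeff (a + 1) (Suc n) / real (Suc n) powr a
      \<le> binom_coeff (a + 1) n / real n powr a"
    using assms(1) by (metis add_nonneg_nonneg binom_coeff_nonneg divide_nonneg_nonneg mult_left_le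
        powr_ge_zero zero_le_one)
  with step.IH show ?case by linarith
qed simp

lemma eventually_less_nat_powr:
  assumes "0 < \<alpha>"
  shows "\<forall>\<^sub>F n in sequentially. y < real n powr \<alpha>"
proof -
  have "\<forall>\<^sub>F n in sequentially. max 1 y powr (1 / \<alpha>) < real n"
    using filterlim_real_sequentially by (simp add: filterlim_at_top_dense)
  then show ?thesis
  proof eventually_elim
    case (elim n)
    from powr_less_mono2[OF assms _ elim] show ?case
      using assms by (simp add: powr_powr)
  qed
qed

text \<open>
  With step size \<open>1 / n\<close> the index \<open>n\<close> corresponds to time \<open>1\<close>. Termwise convergence is the asymptotics of
  the coefficients. For domination, fix \<open>N\<close> with \<open>\<bar>y\<bar> < N powr \<alpha>\<close>: by monotonicity the \<open>k\<close>-th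
  term is bounded, for all \<open>n \<ge> N\<close>, by its value at \<open>N\<close>, and these values are summable over \<open>k\<close>.
\<close>

lemma discrete_mittag_leffler_tendsto:
  fixes y :: real
  assumes "0 < \<alpha>" "\<alpha> \<le> 1"
  shows "summable (\<lambda>k. \<bar>y\<bar> ^ k / Gamma (\<alpha> * real k + 1))"
    and "(\<lambda>n. discrete_mittag_leffler \<alpha> (y / real n powr \<alpha>) n)
           \<longlonglongrightarrow> mittag_leffler \<alpha> 1 (- y)"
proof -
  have "\<forall>\<^sub>F n in sequentially. 0 < n \<and> \<bar>y\<bar> < real n powr \<alpha>"
    by (intro eventually_conj eventually_gt_at_top eventually_less_nat_powr assms(1))
  then obtain N where N: "0 < N" "\<bar>y\<bar> < real N powr \<alpha>"
    by (auto simp: eventually_sequentially)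
  define r where "r = \<bar>y\<bar> / real N powr \<alpha>"
  have r: "0 \<le> r" "r < 1"
    using N by (auto simp: r_def)
  have power: "(z / real n powr \<alpha>) ^ k = z ^ k / real n powr (\<alpha> * real k)"
    if "0 < n" for z k n
    using that by (simp add: power_divide powr_powr flip: powr_realpow)
  have bound: "\<bar>y\<bar> ^ k * (binom_coeff (\<alpha> * real k + 1) n / real n powr (\<alpha> * real k))
      \<le> \<bar>r\<bar> ^ k * binom_coeff (\<alpha> * real k + 1) N" if "N \<le> n" for k n
    using binom_coeff_ratio_antimono[of "\<alpha> * real k" N n] assms N that r
    by (simp add: r_def power mult_left_mono flip: times_divide_eq_right)
  have lim: "(\<lambda>n. z ^ k * (binom_coeff (\<alpha> * real k + 1) n / real n powr (\<alpha> * real k)))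
      \<longlonglongrightarrow> z ^ k / Gamma (\<alpha> * real k + 1)" for z k
    using tendsto_mult_left[OF binom_coeff_asymptotics, of "\<alpha> * real k" "z ^ k"] assms
    by simp
  have dominated: "summable (\<lambda>k. \<bar>r\<bar> ^ k * binom_coeff (\<alpha> * real k + 1) N)"
    using assms r by (intro summable_binom_coeff) auto
  show "summable (\<lambda>k. \<bar>y\<bar> ^ k / Gamma (\<alpha> * real k + 1))"
  proof (rule summable_comparison_test'[OF dominated])
    fix k :: nat
    have "\<bar>y\<bar> ^ k / Gamma (\<alpha> * real k + 1) \<le> \<bar>r\<bar> ^ k * binom_coeff (\<alpha> * real k + 1) N"
      by (rule Lim_bounded[OF lim]) (use bound in blast)
    moreover have "0 < Gamma (\<alpha> * real k + 1)"
      using assms by (intro Gamma_real_pos) (simp add: add_nonneg_pos)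
    ultimately show "norm (\<bar>y\<bar> ^ k / Gamma (\<alpha> * real k + 1))
        \<le> \<bar>r\<bar> ^ k * binom_coeff (\<alpha> * real k + 1) N"
      by (simp add: abs_mult)
  qed
  have "norm ((- y) ^ k * (binom_coeff (\<alpha> * real k + 1) n / real n powr (\<alpha> * real k)))
      \<le> \<bar>r\<bar> ^ k * binom_coeff (\<alpha> * real k + 1) N" if "N \<le> n" for n k
    using bound[OF that, of k] assms
    by (simp add: abs_mult power_abs binom_coeff_nonneg)
  then have "\<forall>\<^sub>F (k, n) in at_top \<times>\<^sub>F sequentially.
      norm ((- y) ^ k * (binom_coeff (\<alpha> * real k + 1) n / real n powr (\<alpha> * real k)))
        \<le> \<bar>r\<bar> ^ k * binom_coeff (\<alpha> * real k + 1) N"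
    by (auto simp: eventually_prod_sequentially case_prod_beta intro!: exI[of _ N])
  from tannerys_theorem[OF lim this dominated]
  have "(\<lambda>n. \<Sum>k. (- y) ^ k * (binom_coeff (\<alpha> * real k + 1) n / real n powr (\<alpha> * real k)))
      \<longlonglongrightarrow> (\<Sum>k. (- y) ^ k / Gamma (\<alpha> * real k + 1))"
    by simp
  moreover have "\<forall>\<^sub>F n in sequentially.
      (\<Sum>k. (- y) ^ k * (binom_coeff (\<alpha> * real k + 1) n / real n powr (\<alpha> * real k)))
        = discrete_mittag_leffler \<alpha> (y / real n powr \<alpha>) n"
    using eventually_gt_at_top[of 0]
  proof eventually_elim
    case (elim n)
    then show ?case
      using power[OF elim, of "- y"]
      by (simp add: discrete_mittag_leffler_def)
  qed
  ultimately show "(\<lambda>n. discrete_mittag_leffler \<alpha> (y / real n powr \<alpha>) n)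
      \<longlonglongrightarrow> mittag_leffler \<alpha> 1 (- y)"
    unfolding mittag_leffler_def by (rule Lim_transform_eventually)
qed

text \<open>
  The linear lower bound for the scheme, with \<open>x = y / n powr \<alpha>\<close>, tends to
  \<open>1 - y / Gamma (\<alpha> + 1)\<close>, and the scheme tends to the Mittag-Leffler function; this settles
  \<open>z = - y < 0\<close>. For \<open>z \<ge> 0\<close> all terms of the series are nonnegative and the first two suffice.
\<close>

theorem mittag_leffler_ge_linear:
  assumes "0 < \<alpha>" "\<alpha> \<le> 1"
  shows "1 + z / Gamma (\<alpha> + 1) \<le> mittag_leffler \<alpha> 1 z"
proof (cases "0 \<le> z")
  case True
  have pos: "0 < Gamma (\<alpha> * real k + 1)" for k
    using assms by (intro Gamma_real_pos) (simp add: add_nonneg_pos)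
  have "(\<Sum>k<2. z ^ k / Gamma (\<alpha> * real k + 1)) \<le> mittag_leffler \<alpha> 1 z"
    unfolding mittag_leffler_def
    using discrete_mittag_leffler_tendsto(1)[OF assms, of z] True pos
    by (intro sum_le_suminf) (auto simp: less_imp_le)
  then show ?thesis by (simp add: numeral_2_eq_2)
next
  case False
  define y where "y = - z"
  have y: "0 \<le> y" "z = - y" using False by (auto simp: y_def)
  have "(\<lambda>n. 1 - y * (binom_coeff (\<alpha> + 1) n / real n powr \<alpha>)) \<longlonglongrightarrow> 1 - y * (1 / Gamma (\<alpha> + 1))"
    using assms by (intro tendsto_intros binom_coeff_asymptotics) simp
  moreover have "\<forall>\<^sub>F n in sequentially. 1 - y * (binom_coeff (\<alpha> + 1) n / real n powr \<alpha>)
      \<le> discrete_mittag_leffler \<alpha> (y / real n powr \<alpha>) n"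
  proof -
    have "\<forall>\<^sub>F n in sequentially. y < real n powr \<alpha>"
      by (rule eventually_less_nat_powr[OF assms(1)])
    then show ?thesis
    proof eventually_elim
      case (elim n)
      with y(1) have "0 < real n powr \<alpha>" by linarith
      with elim have "y / real n powr \<alpha> < 1"
        by (simp only: divide_less_eq_1_pos)
      then show ?case
        using discrete_mittag_leffler_ge[of \<alpha> "y / real n powr \<alpha>" n] assms y(1) by simp
    qed
  qed
  ultimately have "1 - y * (1 / Gamma (\<alpha> + 1)) \<le> mittag_leffler \<alpha> 1 (- y)"
    using discrete_mittag_leffler_tendsto(2)[OF assms, of y]
    by (intro tendsto_le[OF trivial_limit_sequentially]) auto
  then show ?thesis by (simp add: y)
qed

section \<open>Decay of solutions\<close>

text \<open>
  The sum has the same coefficients as \<open>u0\<close>, so the difference is orthogonal to a set with dense span.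
  That the series converges is an assumption because the definition of a solution supplies it.
\<close>

lemma eigenbasis_expansion_unique:
  assumes "eigenbasis D A I \<phi> lam"
    and "(\<lambda>n. if n \<in> I then inner u0 (\<phi> n) *\<^sub>R \<phi> n else 0) sums v"
  shows "v = u0"
proof -
  have ortho: "inner (\<phi> m) (\<phi> n) = (if m = n then 1 else 0)" if "m \<in> I" "n \<in> I" for m n
    using assms(1) that by (simp add: eigenbasis_def)
  have "inner (\<phi> m) (v - u0) = 0" if "m \<in> I" for m
  proof -
    have "(\<lambda>n. inner (\<phi> m) (if n \<in> I then inner u0 (\<phi> n) *\<^sub>R \<phi> n else 0)) sums inner (\<phi> m) v"
      by (rule bounded_linear.sums[OF bounded_linear_inner_right assms(2)])
    moreover have "inner (\<phi> m) (if n \<in> I then inner u0 (\<phi> n) *\<^sub>R \<phi> n else 0)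
        = (if n = m then inner u0 (\<phi> m) else 0)" for n
      using that by (simp add: ortho)
    ultimately have "inner (\<phi> m) v = inner u0 (\<phi> m)"
      using sums_single[of m "\<lambda>_. inner u0 (\<phi> m)"] sums_unique2 by auto
    then show ?thesis
      by (simp add: inner_diff_right inner_commute)
  qed
  then have "span (\<phi> ` I) \<subseteq> {x. inner x (v - u0) = 0}"
    by (intro span_minimal) (auto simp: subspace_def inner_add_left)
  then have "closure (span (\<phi> ` I)) \<subseteq> {x. inner x (v - u0) = 0}"
    by (intro closure_minimal closed_Collect_eq continuous_intros)
  then have "inner (v - u0) (v - u0) = 0"
    using assms(1) by (simp add: eigenbasis_def subset_iff)
  then show ?thesis by simp
qed

lemma self_adjoint_symmetric:
  assumes "self_adjoint D A" "x \<in> D" "y \<in> D"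
  shows "inner (A x) y = inner x (A y)"
proof -
  have "(y, A y) \<in> adjoint_graph D A"
    using assms by (auto simp: self_adjoint_def op_graph_def)
  then show ?thesis
    using assms(2) by (simp add: adjoint_graph_def)
qed

text \<open>
  All three quantities are sums over the eigenbasis, the last one by symmetry of \<open>A\<close>, and the
  summands are compared by the linear lower bound of the Mittag-Leffler function.
\<close>

lemma solution_decay_estimate:
  fixes D :: "'a::real_inner set"
  assumes "self_adjoint D A" "0 < \<alpha>" "\<alpha> \<le> 1" "u0 \<in> D" "is_solution D A \<alpha> T u0 u"
    and t: "0 \<le> t" "t \<le> T"
  shows "(norm u0)\<^sup>2 - inner (u t) u0 \<le> t powr \<alpha> / Gamma (\<alpha> + 1) * - inner (A u0) u0"
proof -
  obtain I \<phi> lam where basis: "eigenbasis D A I \<phi> lam"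
    and u: "\<And>s. 0 \<le> s \<Longrightarrow> s \<le> T \<Longrightarrow>
      (\<lambda>n. if n \<in> I
           then (inner u0 (\<phi> n) * mittag_leffler \<alpha> 1 (- lam n * s powr \<alpha>)) *\<^sub>R \<phi> n
           else 0) sums u s"
    using assms(5) by (auto simp: is_solution_def)
  define c where "c n = (if n \<in> I then inner u0 (\<phi> n) else 0)" for n
  have "mittag_leffler \<alpha> 1 0 = 1"
    using powser_zero[of "\<lambda>k. 1 / Gamma (\<alpha> * real k + 1)"] by (simp add: mittag_leffler_def)
  then have "(\<lambda>n. if n \<in> I then inner u0 (\<phi> n) *\<^sub>R \<phi> n else 0) sums u 0"
    using u[of 0] t by (simp cong: if_cong)
  \<comment> \<open>The initial value of the solution is \<open>u0\<close>, so \<open>u0\<close> is the sum of its own expansion.\<close>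
  with eigenbasis_expansion_unique[OF basis this]
  have u0: "(\<lambda>n. if n \<in> I then inner u0 (\<phi> n) *\<^sub>R \<phi> n else 0) sums u0"
    by simp
  have norm_sums: "(\<lambda>n. (c n)\<^sup>2) sums (norm u0)\<^sup>2"
  proof -
    have "inner u0 (if n \<in> I then inner u0 (\<phi> n) *\<^sub>R \<phi> n else 0) = (c n)\<^sup>2" for n
      by (simp add: c_def power2_eq_square)
    then show ?thesis
      using bounded_linear.sums[OF bounded_linear_inner_right[of u0] u0]
      by (simp add: power2_norm_eq_inner)
  qed
  have "(\<lambda>n. (c n)\<^sup>2 * lam n) sums (- inner (A u0) u0)"
  proof -
    have "(\<lambda>n. inner (A u0) (if n \<in> I then inner u0 (\<phi> n) *\<^sub>R \<phi> n else 0)) sums inner (A u0) u0"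
      by (rule bounded_linear.sums[OF bounded_linear_inner_right u0])
    moreover have "inner (A u0) (if n \<in> I then inner u0 (\<phi> n) *\<^sub>R \<phi> n else 0)
        = - ((c n)\<^sup>2 * lam n)" for n
    proof (cases "n \<in> I")
      case True
      then have eigen: "\<phi> n \<in> D" "- A (\<phi> n) = lam n *\<^sub>R \<phi> n"
        using basis by (simp_all add: eigenbasis_def)
      from eigen(2) have "A (\<phi> n) = - (lam n *\<^sub>R \<phi> n)"
        by (metis minus_minus)
      then have "inner (A u0) (\<phi> n) = - (lam n * inner u0 (\<phi> n))"
        using self_adjoint_symmetric[OF assms(1,4) eigen(1)] by simp
      with True show ?thesis
        by (simp add: c_def power2_eq_square)
    qed (simp add: c_def)
    ultimately show ?thesis
      using sums_minus by fastforce
  qed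
  then have energy_sums: "(\<lambda>n. t powr \<alpha> / Gamma (\<alpha> + 1) * ((c n)\<^sup>2 * lam n)) sums
      (t powr \<alpha> / Gamma (\<alpha> + 1) * - inner (A u0) u0)"
    by (rule sums_mult)
  have "(\<lambda>n. (c n)\<^sup>2 * mittag_leffler \<alpha> 1 (- lam n * t powr \<alpha>)) sums inner (u t) u0"
  proof -
    have "inner u0 (if n \<in> I
          then (inner u0 (\<phi> n) * mittag_leffler \<alpha> 1 (- lam n * t powr \<alpha>)) *\<^sub>R \<phi> n else 0)
        = (c n)\<^sup>2 * mittag_leffler \<alpha> 1 (- lam n * t powr \<alpha>)" for n
      by (simp add: c_def power2_eq_square)
    then show ?thesis
      using bounded_linear.sums[OF bounded_linear_inner_right[of u0] u[OF t]]
      by (simp add: inner_commute[of u0 "u t"])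
  qed
  with norm_sums have "(\<lambda>n. (c n)\<^sup>2 - (c n)\<^sup>2 * mittag_leffler \<alpha> 1 (- lam n * t powr \<alpha>)) sums
      ((norm u0)\<^sup>2 - inner (u t) u0)"
    by (rule sums_diff)
  from this energy_sums show ?thesis
  proof (rule sums_le[rotated])
    fix n
    have "1 - mittag_leffler \<alpha> 1 (- lam n * t powr \<alpha>) \<le> t powr \<alpha> / Gamma (\<alpha> + 1) * lam n"
      using mittag_leffler_ge_linear[OF assms(2,3), of "- lam n * t powr \<alpha>"]
      by (simp add: mult.commute)
    from mult_left_mono[OF this, of "(c n)\<^sup>2"]
    show "(c n)\<^sup>2 - (c n)\<^sup>2 * mittag_leffler \<alpha> 1 (- lam n * t powr \<alpha>)
        \<le> t powr \<alpha> / Gamma (\<alpha> + 1) * ((c n)\<^sup>2 * lam n)"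
      by (simp add: algebra_simps)
  qed
qed

section \<open>The stability estimate\<close>

text \<open>
  The hypothesis is the square of the conclusion at \<open>\<theta> = 0\<close> with strict inequality. It persists near
  \<open>0\<close> because the right-hand side is continuous in \<open>\<theta>\<close> for positive \<open>b\<close> and \<open>R\<close>.
\<close>

lemma small_exponent_exists:
  fixes a b c R :: real
  assumes "0 < b" "0 < R" "a\<^sup>2 < b\<^sup>2 + c * R\<^sup>2"
  shows "\<exists>\<theta>. 0 < \<theta> \<and> \<theta> < 1 / 2 \<and>
    a \<le> b powr \<theta> * sqrt (b powr (2 - 2 * \<theta>) + c * R powr (2 - 2 * \<theta>))"
proof -
  let ?g = "\<lambda>\<theta>. b powr \<theta> * sqrt (b powr (2 - 2 * \<theta>) + c * R powr (2 - 2 * \<theta>))"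
  have "(?g \<longlongrightarrow> b powr 0 * sqrt (b powr (2 - 2 * 0) + c * R powr (2 - 2 * 0))) (at_right 0)"
    using assms by (intro tendsto_intros) auto
  moreover have "a < b powr 0 * sqrt (b powr (2 - 2 * 0) + c * R powr (2 - 2 * 0))"
    using assms by (simp add: powr_numeral real_less_rsqrt)
  ultimately have "\<forall>\<^sub>F \<theta> in at_right 0. a < ?g \<theta>"
    by (rule order_tendstoD)
  moreover have "\<forall>\<^sub>F \<theta> in at_right (0::real). \<theta> \<in> {0<..<1/2}"
    by (rule eventually_at_right_real) simp
  ultimately have "\<forall>\<^sub>F \<theta> in at_right 0. 0 < \<theta> \<and> \<theta> < 1 / 2 \<and> a \<le> ?g \<theta>"
    by eventually_elim auto
  then show ?thesis
    using eventually_happens trivial_limit_at_right_real by blast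
qed

text \<open>
  Since \<open>inner (u t) u0 = 0\<close> for small \<open>t > 0\<close>, the decay estimate bounds \<open>(norm u0)\<^sup>2\<close> by a multiple
  of \<open>t powr \<alpha>\<close>.
\<close>

lemma solution_vanishing_imp_initial_vanishing:
  fixes D :: "'a::real_inner set"
  assumes "self_adjoint D A" "0 < \<alpha>" "\<alpha> \<le> 1" "0 < T" "u0 \<in> D" "is_solution D A \<alpha> T u0 u"
    and vanish: "\<And>t. 0 < t \<Longrightarrow> t < T \<Longrightarrow> u t = 0"
  shows "u0 = 0"
proof -
  have "Gamma (\<alpha> + 1) \<noteq> 0"
    using Gamma_real_pos[of "\<alpha> + 1"] assms(2) by linarith
  then have "((\<lambda>t. t powr \<alpha> / Gamma (\<alpha> + 1) * - inner (A u0) u0)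
      \<longlongrightarrow> 0 powr \<alpha> / Gamma (\<alpha> + 1) * - inner (A u0) u0) (at_right 0)"
    using assms(2)
    by (intro tendsto_intros tendsto_powr')
      (auto intro: eventually_mono[OF eventually_at_right_less])
  moreover have "\<forall>\<^sub>F t in at_right 0.
      (norm u0)\<^sup>2 \<le> t powr \<alpha> / Gamma (\<alpha> + 1) * - inner (A u0) u0"
    using eventually_at_right_real[OF assms(4)]
  proof eventually_elim
    case (elim t)
    then show ?case
      using solution_decay_estimate[OF assms(1-3,5,6), of t] vanish[of t] by simp
  qed
  ultimately have "(norm u0)\<^sup>2 \<le> 0 powr \<alpha> / Gamma (\<alpha> + 1) * - inner (A u0) u0"
    by (rule tendsto_lowerbound) simp
  then show ?thesis by simp
qed

theorem theorem1p2:
  fixes D :: "'a::{real_inner, complete_space} set" and A :: "'a \<Rightarrow> 'a"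
    and \<alpha> T R K :: real and u0 :: 'a and u :: "real \<Rightarrow> 'a"
  assumes "separable_space (euclidean :: 'a topology)"
    and "0 < \<alpha>" and "\<alpha> \<le> 1" and "0 < T" and "0 < R"
    and "admissible_operator D A"
    and "1 \<le> K"
    and "\<And>v0 v t. is_solution D A \<alpha> T v0 v \<Longrightarrow> 0 \<le> t \<Longrightarrow> t \<le> T \<Longrightarrow>
           norm (v t) \<le> K * rpow (norm (v 0)) (1 - t / T) * rpow (norm (v T)) (t / T)"
    and "u0 \<in> D" and "norm (A u0) \<le> R" and "norm u0 \<le> R"
    and "is_solution D A \<alpha> T u0 u"
  shows "\<exists>\<theta>. 0 < \<theta> \<and> \<theta> < 1 / 2 \<and>
           norm u0 \<le> norm (u T) powr \<theta> *
             sqrt (norm (u T) powr (2 - 2 * \<theta>) +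
                   K * R powr (2 - 2 * \<theta>) * (2 * T powr \<alpha> / (\<alpha> * Gamma \<alpha>)))"
proof -
  have sa: "self_adjoint D A"
    using assms(6) by (simp add: admissible_operator_def)
  show ?thesis
  proof (cases "u T = 0")
    case True
    have "u t = 0" if "0 < t" "t < T" for t
      using assms(8)[OF assms(12), of t] that True by (simp add: rpow_def)
    then have "u0 = 0"
      using solution_vanishing_imp_initial_vanishing[OF sa assms(2-4,9,12)] by blast
    then show ?thesis
      by (intro exI[of _ "1 / 4"]) (simp add: True)
  next
    case False
    define M where "M = T powr \<alpha> / (\<alpha> * Gamma \<alpha>)"
    have M: "0 < M" "T powr \<alpha> / Gamma (\<alpha> + 1) = M"
      using assms(2,4) Gamma_real_pos[of \<alpha>] Gamma_plus1[of \<alpha>] nonpos_Ints_nonpos[of \<alpha>]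
      by (auto simp: M_def)
    have "(norm u0)\<^sup>2 \<le> inner (u T) u0 + M * - inner (A u0) u0"
      using solution_decay_estimate[OF sa assms(2,3,9,12), of T] assms(4) M(2) by simp
    also have "inner (u T) u0 \<le> norm (u T) * norm u0"
      by (rule norm_cauchy_schwarz)
    also have "M * - inner (A u0) u0 \<le> K * M * R\<^sup>2"
    proof -
      have "- inner (A u0) u0 \<le> norm (A u0) * norm u0"
        using Cauchy_Schwarz_ineq2[of "A u0" u0] by linarith
      also have "\<dots> \<le> R * R"
        using assms(5,10,11) by (intro mult_mono) auto
      finally have "M * - inner (A u0) u0 \<le> M * R\<^sup>2"
        using M(1) by (intro mult_left_mono) (auto simp: power2_eq_square)
      also have "\<dots> \<le> K * (M * R\<^sup>2)"
        using mult_right_mono[OF assms(7), of "M * R\<^sup>2"] M(1) by simp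
      finally show ?thesis by (simp add: mult.assoc)
    qed
    finally have bound: "(norm u0)\<^sup>2 \<le> norm (u T) * norm u0 + K * M * R\<^sup>2"
      by simp
    have pos: "0 < K * M * R\<^sup>2"
      using assms(5,7) M(1) by simp
    \<comment> \<open>The arithmetic-geometric mean inequality is strict unless the norms agree.\<close>
    have "(norm u0)\<^sup>2 < (norm (u T))\<^sup>2 + 2 * K * M * R\<^sup>2"
    proof (cases "norm u0 = norm (u T)")
      case True
      then show ?thesis using pos by simp
    next
      case False
      then have "0 < (norm (u T) - norm u0)\<^sup>2" by simp
      with bound show ?thesis by (simp add: power2_diff)
    qed
    from small_exponent_exists[OF _ assms(5) this] False show ?thesis
      by (simp add: M_def mult_ac)
  qed
qed

end
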